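(* Let $G=(V,E,\omega)$ be a finite directed non-negatively weighted graph, $r\in V$ a root and $k\ge 1$ an integer. Algorithm Bounded-S-kSSP (described in the context), run on input $(G,r,k)$, solves the Single-Source Top-$k$ Simple Shortest Paths problem: it terminates and, at termination, for every $v\in V\setminus\{r\}$ the collection $T_v$ is a collection of top-$k$ simple shortest paths from $r$ to $v$.
   Context: Graphs. $G=(V,E,\omega)$ is a finite directed graph with $n=|V|$, $m=|E|$, $E\subseteq V\times V$, and $\omega$ assigns a non-negative real weight to each edge. $N^+(v)=\{u:(v,u)\in E\}$. A path from $s$ to $t$ is a vertex sequence $P=(s=v_1,\dots,v_\eta=t)$, $\eta\ge 1$, with $(v_i,v_{i+1})\in E$ for all $i<\eta$; $V(P)$ is its vertex set; it is simple if it has no repeated vertex; its weight is $\omega(P)=\sum_{i=1}^{\eta-1}\omega(v_i,v_{i+1})$. For a path $\Pi$ ending at $v$ and an edge $(v,u)$, $\Pi\oplus(u)$ is $\Pi$ extended by $u$. Problem. A collection of top-$k$ simple shortest paths from $s$ to $t$ is a set of pairwise distinct simple paths from $s$ to $t$ that contains all simple $s$–$t$ paths if there are fewer than $k$ of them, and otherwise contains exactly $k$ simple $s$–$t$ paths such that every simple $s$–$t$ path not in the set has weight at least that of every path in the set. Computing such a set for one pair $(s,t)$ is the single-pair problem P-kSSP. Given a root $r$, $\Gamma_{rv}$ is the family of all collections of top-$k$ simple shortest paths from $r$ to $v$ (there may be several because of ties; $\Gamma_{rr}=\{\{(r)\}\}$). The Single-Source Top-$k$ Simple Shortest Paths problem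 asks for an element of $\Gamma_{rv}$ for each $v\in V\setminus\{r\}$. For a collection $S_{rw}\in\Gamma_{rw}$, the predecessors of $w$ are the vertices $u\ne w$ lying on some path of $S_{rw}$. Given a choice of collections $S_{rw}$, the set of general predecessors of $v$ is the smallest set of vertices containing $v$ and containing, with each $w$, all predecessors of $w$. Algorithm Bounded-S-kSSP. Maintain a list $T_v$ of paths for each $v\in V$ (initially empty), a min-priority queue $PQ$ of paths keyed by weight (initially containing only the trivial path $(r)$ with key $0$), and a mark "super-saturated" on vertices (initially no vertex is marked). While $PQ\neq\emptyset$ and there is $w\neq r$ with $|T_w|<k$: 1. Remove from $PQ$ a path $\Pi=(r,\dots,v)$ of minimum weight. 2. If $|T_v|<k$: add $\Pi$ to $T_v$; then for each $u\in N^+(v)\setminus V(\Pi)$ such that $u$ is not super-saturated and $\Pi\oplus(u)\notin PQ$, insert $\Pi\oplus(u)$ into $PQ$ with key $\omega(\Pi)+\omega(v,u)$. 3. Otherwise (i.e. $|T_v|=k$), if $v$ is not super-saturated: for each general predecessor $w$ of $v$ (including $v$ itself; the set is explored by closure starting from $v$, using the collections $S_{rw}$ computed here; vertices already super-saturated need not be processed again), compute a collection $S_{rw}\in\Gamma_{rw}$ with $S_{rw}\supseteq T_w$ (this is $T_w$ itself if $|T_w|=k$, and otherwise it is obtained by an algorithm for P-kSSP on the pair $(r,w)$); insert into $PQ$, with key its weight, every path $p\in S_{rw}\setminus T_w$ with $p\notin PQ$; and mark $w$ super-saturated. 4. Otherwise do nothing. The output is $(T_v)_{v\in V\setminus\{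r\}}$.
   Formalization: With arbitrary tie-breaking the claim is false; the formal version adds a rule: among minimum-weight paths in PQ ending at the same super-saturated vertex w, those in the computed collection S_rw are removed first. Termination is proved without this rule. *)

theory Defs
  imports
    "Graph_Theory.Pair_Digraph"
    "Graph_Theory.Vertex_Walk"
    "Graph_Theory.Weighted_Graph"
begin

definition simple_paths :: "'a pair_pre_digraph \<Rightarrow> 'a \<Rightarrow> 'a \<Rightarrow> 'a list set" where
  "simple_paths G s t = {p. vpath p (with_proj G) \<and> hd p = s \<and> last p = t}"

definition path_weight :: "('a \<times> 'a) weight_fun \<Rightarrow> 'a list \<Rightarrow> real" where
  "path_weight \<omega> p = sum_list (map \<omega> (vwalk_arcs p))"

text \<open>
  The family of all collections of top-\<open>k\<close> simple shortest paths from \<open>s\<close> to \<open>t\<close>.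
  For finite \<open>G\<close> the set of simple paths is finite, so its \<open>card\<close> is the true number of paths.
\<close>

definition top_k_collections ::
  "'a pair_pre_digraph \<Rightarrow> ('a \<times> 'a) weight_fun \<Rightarrow> nat \<Rightarrow> 'a \<Rightarrow> 'a \<Rightarrow> 'a list set set" where
  "top_k_collections G \<omega> k s t =
     {S. S \<subseteq> simple_paths G s t \<and>
         (if card (simple_paths G s t) < k then S = simple_paths G s t
          else card S = k \<and>
               (\<forall>p \<in> simple_paths G s t - S. \<forall>q \<in> S. path_weight \<omega> q \<le> path_weight \<omega> p))}"

definition predecessors :: "('a \<Rightarrow> 'a list set) \<Rightarrow> 'a \<Rightarrow> 'a set" where
  "predecessors S w = {u. u \<noteq> w \<and> (\<exists>p \<in> S w. u \<in> set p)}"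

inductive_set general_predecessors :: "('a \<Rightarrow> 'a list set) \<Rightarrow> 'a \<Rightarrow> 'a set"
  for S :: "'a \<Rightarrow> 'a list set" and v :: 'a where
  self: "v \<in> general_predecessors S v"
| pred: "\<lbrakk>w \<in> general_predecessors S v; u \<in> predecessors S w\<rbrakk>
         \<Longrightarrow> u \<in> general_predecessors S v"

text \<open>
  The queue is a set of paths: a path is only ever inserted when it is not already queued, and its
  key is always its weight. The component \<open>coll\<close> remembers, for each super-saturated vertex, the
  collection that was computed when the vertex was marked; its values elsewhere are irrelevant.
\<close>

record 'a kssp_state =
  paths :: "'a \<Rightarrow> 'a list list"
  queue :: "'a list set"
  supersat :: "'a set"
  coll :: "'a \<Rightarrow> 'a list set"

definition initial_state :: "'a \<Rightarrow> 'a kssp_state" where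
  "initial_state r = \<lparr>paths = (\<lambda>_. []), queue = {[r]}, supersat = {}, coll = (\<lambda>_. {})\<rparr>"

definition loop_guard :: "'a pair_pre_digraph \<Rightarrow> 'a \<Rightarrow> nat \<Rightarrow> 'a kssp_state \<Rightarrow> bool" where
  "loop_guard G r k s \<longleftrightarrow>
     queue s \<noteq> {} \<and> (\<exists>w \<in> pverts G. w \<noteq> r \<and> length (paths s w) < k)"

definition min_queued :: "('a \<times> 'a) weight_fun \<Rightarrow> 'a kssp_state \<Rightarrow> 'a list \<Rightarrow> bool" where
  "min_queued \<omega> s p \<longleftrightarrow>
     p \<in> queue s \<and> (\<forall>q \<in> queue s. path_weight \<omega> p \<le> path_weight \<omega> q)"

text \<open>
  A choice of collections available in state \<open>s\<close>: the stored one for a vertex that is already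
  super-saturated, and a collection extending the current list otherwise. A choice is made for
  every vertex, but an iteration uses it only on the general predecessors of one vertex.
\<close>

definition admissible_choice ::
  "'a pair_pre_digraph \<Rightarrow> ('a \<times> 'a) weight_fun \<Rightarrow> 'a \<Rightarrow> nat \<Rightarrow> 'a kssp_state \<Rightarrow>
   ('a \<Rightarrow> 'a list set) \<Rightarrow> bool" where
  "admissible_choice G \<omega> r k s S \<longleftrightarrow>
     (\<forall>w \<in> pverts G.
        if w \<in> supersat s then S w = coll s w
        else S w \<in> top_k_collections G \<omega> k r w \<and> set (paths s w) \<subseteq> S w \<and>
             (length (paths s w) = k \<longrightarrow> S w = set (paths s w)))"

text \<open>
  \<open>iteration G \<omega> r k s p s'\<close>: one execution of the loop body, started in \<open>s\<close>, removing \<open>p\<close> from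
  the queue and ending in \<open>s'\<close>. All choices the algorithm leaves open are nondeterministic. Since
  the queue is a set, the tests for paths already queued are absorbed by the unions.
\<close>

inductive iteration ::
  "'a pair_pre_digraph \<Rightarrow> ('a \<times> 'a) weight_fun \<Rightarrow> 'a \<Rightarrow> nat \<Rightarrow>
   'a kssp_state \<Rightarrow> 'a list \<Rightarrow> 'a kssp_state \<Rightarrow> bool"
  for G :: "'a pair_pre_digraph" and \<omega> :: "('a \<times> 'a) weight_fun" and r :: 'a and k :: nat where
  extend:
    "\<lbrakk>loop_guard G r k s; min_queued \<omega> s p; v = last p;
      length (paths s v) < k;
      s' = s\<lparr>paths := (paths s)(v := paths s v @ [p]),
             queue := (queue s - {p}) \<union>
               {p @ [u] | u. (v, u) \<in> parcs G \<and> u \<notin> set p \<and> u \<notin> supersat s}\<rparr>\<rbrakk>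
     \<Longrightarrow> iteration G \<omega> r k s p s'"
| supersaturate:
    "\<lbrakk>loop_guard G r k s; min_queued \<omega> s p; v = last p;
      \<not> length (paths s v) < k; v \<notin> supersat s;
      admissible_choice G \<omega> r k s S;
      X = general_predecessors S v - supersat s;
      s' = s\<lparr>queue := (queue s - {p}) \<union> (\<Union>w \<in> X. S w - set (paths s w)),
             supersat := supersat s \<union> X,
             coll := (\<lambda>w. if w \<in> X then S w else coll s w)\<rparr>\<rbrakk>
     \<Longrightarrow> iteration G \<omega> r k s p s'"
| discard:
    "\<lbrakk>loop_guard G r k s; min_queued \<omega> s p; v = last p;
      \<not> length (paths s v) < k; v \<in> supersat s;
      s' = s\<lparr>queue := queue s - {p}\<rparr>\<rbrakk>
     \<Longrightarrow> iteration G \<omega> r k s p s'"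

text \<open>
  Convention for ties in the queue. Among queued paths of equal minimum weight that end at the same
  super-saturated vertex, those in the collection computed for that vertex are removed first; all
  other ties are broken arbitrarily. Without some such coordination the algorithm is incorrect: the
  list of a super-saturated vertex \<open>y\<close> may be filled with queued paths that tie with, but do not
  belong to, the collection computed for \<open>y\<close>. The members of that collection are then discarded and
  never extended, while the paths replacing them may run through vertices that are not
  super-saturated and hence not be extendable to them. The convention holds trivially if no two
  simple paths with the same end have equal weight, and it holds if one fixed linear order on paths
  refining the weight is used both by the queue and for selecting the computed collections.
\<close>

definition tie_convention :: "('a \<times> 'a) weight_fun \<Rightarrow> 'a kssp_state \<Rightarrow> 'a list \<Rightarrow> bool" where
  "tie_convention \<omega> s p \<longleftrightarrow>
     (\<forall>q \<in> queue s.
        last q = last p \<and> last p \<in> supersat s \<and> path_weight \<omega> q = path_weight \<omega> p \<and>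
        q \<in> coll s (last p) \<longrightarrow> p \<in> coll s (last p))"

definition reachable_state ::
  "'a pair_pre_digraph \<Rightarrow> ('a \<times> 'a) weight_fun \<Rightarrow> 'a \<Rightarrow> nat \<Rightarrow> 'a kssp_state \<Rightarrow> bool" where
  "reachable_state G \<omega> r k =
     (\<lambda>s s'. \<exists>p. tie_convention \<omega> s p \<and> iteration G \<omega> r k s p s')\<^sup>*\<^sup>* (initial_state r)"

end

theory Submission
  imports Defs
begin

text \<open>
  Let \<open>T v\<close> be the list of \<open>v\<close>. For a super-saturated vertex \<open>w\<close> with collection \<open>C w\<close>, the loop
  maintains \<open>T w \<subseteq> C w \<subseteq> T w \<union> queue\<close>; for any other vertex \<open>v\<close>, the paths in \<open>T v\<close> are no heavier
  than the remaining simple paths to \<open>v\<close>. The latter rests on a coverage property: if \<open>v\<close> is not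
  super-saturated and has fewer than \<open>k\<close> paths, then every simple path \<open>q\<close> to \<open>v\<close> outside \<open>T v\<close> is
  no lighter than some queued path. To see this, write \<open>q = a @ b\<close> with \<open>a\<close> ending at the last
  super-saturated vertex \<open>x\<close> of \<open>q\<close>. Along \<open>b\<close> every extension of a listed path is queued or
  listed, so only \<open>a \<notin> C x = T x\<close> is critical. In that case \<open>C x\<close> consists of \<open>k\<close> paths no heavier
  than \<open>a\<close>; since general predecessors are super-saturated together with \<open>x\<close>, these paths avoid
  \<open>b\<close>, and one of their \<open>k\<close> continuations by \<open>b\<close> is not yet listed at \<open>v\<close>.

  Termination: each iteration decreases lexicographically the number of free places in the lists,
  the number of vertices that are not super-saturated, and the size of the queue.
\<close>

section \<open>Simple paths and their weights\<close>

lemma path_weight_snoc: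
  "p \<noteq> [] \<Longrightarrow> path_weight \<omega> (p @ [u]) = path_weight \<omega> p + \<omega> (last p, u)"
  by (simp add: path_weight_def vwalk_arcs_append)

lemma path_weight_append:
  "a \<noteq> [] \<Longrightarrow> path_weight \<omega> (a @ b) = path_weight \<omega> a + path_weight \<omega> (last a # b)"
  by (cases b) (auto simp: path_weight_def vwalk_arcs_append)

lemma simple_paths_snoc_iff:
  assumes "p \<noteq> []"
  shows "p @ [u] \<in> simple_paths G s t \<longleftrightarrow>
    p \<in> simple_paths G s (last p) \<and> (last p, u) \<in> parcs G \<and> u \<in> pverts G \<and> u \<notin> set p \<and> t = u"
  using assms by (auto simp: simple_paths_def vpath_def vwalk_def vwalk_arcs_append)

lemma simple_paths_lastD: "p \<in> simple_paths G s t \<Longrightarrow> last p = t"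
  by (simp add: simple_paths_def)

lemma simple_paths_last: "p \<in> simple_paths G s t \<Longrightarrow> p \<in> simple_paths G s (last p)"
  by (simp add: simple_paths_def)

lemma simple_paths_not_Nil: "p \<in> simple_paths G s t \<Longrightarrow> p \<noteq> []"
  by (auto simp: simple_paths_def)

lemma simple_paths_setD: "p \<in> simple_paths G s t \<Longrightarrow> set p \<subseteq> pverts G"
  by (auto simp: simple_paths_def vpath_def vwalk_def)

lemma simple_paths_self: "r \<in> pverts G \<Longrightarrow> [r] \<in> simple_paths G r r"
  by (auto simp: simple_paths_def vpath_def vwalk_def)

lemma simple_paths_selfD: "p \<in> simple_paths G r r \<Longrightarrow> p = [r]"
  by (cases p) (auto simp: simple_paths_def vpath_def split: if_splits)

lemma simple_paths_prefix:
  assumes "a @ b \<in> simple_paths G s t" "a \<noteq> []"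
  shows "a \<in> simple_paths G s (last a)"
  using assms
  by (auto simp: simple_paths_def vpath_def vwalk_def dest: set_vwalk_arcs_append1[THEN subsetD])

text \<open>Both prefixes end at \<open>last a\<close>, so the arc into \<open>b\<close> survives;
  disjointness keeps the result simple.\<close>

lemma simple_paths_exchange_prefix:
  assumes "a @ b \<in> simple_paths G s t" "a \<noteq> []"
    and "c \<in> simple_paths G s (last a)" "set c \<inter> set b = {}"
  shows "c @ b \<in> simple_paths G s t"
proof (cases "b = []")
  case True
  then show ?thesis using assms by (simp add: simple_paths_def)
next
  case False
  moreover have "c \<noteq> []" using assms(3) by (rule simple_paths_not_Nil)
  ultimately show ?thesis using assms
    by (auto simp: simple_paths_def vpath_def vwalk_def vwalk_arcs_append)
qed

lemma finite_simple_paths: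
  assumes "finite (pverts G)"
  shows "finite (simple_paths G s t)"
proof (rule finite_subset)
  show "simple_paths G s t \<subseteq> {xs. set xs \<subseteq> pverts G \<and> length xs \<le> card (pverts G)}"
  proof
    fix p assume p: "p \<in> simple_paths G s t"
    then have "distinct p" by (auto simp: simple_paths_def)
    then show "p \<in> {xs. set xs \<subseteq> pverts G \<and> length xs \<le> card (pverts G)}"
      using simple_paths_setD[OF p] card_mono[OF assms simple_paths_setD[OF p]]
      by (simp add: distinct_card)
  qed
  show "finite {xs. set xs \<subseteq> pverts G \<and> length xs \<le> card (pverts G)}"
    using assms by (rule finite_lists_length_le)
qed

section \<open>Lightest subsets\<close>

text \<open>The order condition of a top-\<open>k\<close> collection, separated from its size so
  that partially filled lists can satisfy it too.\<close>

definition lightest_in :: "('b \<Rightarrow> real) \<Rightarrow> 'b set \<Rightarrow> 'b set \<Rightarrow> bool" where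
  "lightest_in f A B \<longleftrightarrow> B \<subseteq> A \<and> (\<forall>x \<in> A - B. \<forall>y \<in> B. f y \<le> f x)"

lemma lightest_in_insert:
  assumes "lightest_in f A B" "x \<in> A - B" "\<forall>y \<in> A - B. f x \<le> f y"
  shows "lightest_in f A (insert x B)"
  using assms by (auto simp: lightest_in_def)

text \<open>Greedy argument: a lightest remaining element can always be added without breaking the
  order condition.\<close>

lemma lightest_in_extend:
  assumes "finite A" "lightest_in f A B" "card B \<le> n" "n \<le> card A"
  shows "\<exists>C. B \<subseteq> C \<and> lightest_in f A C \<and> card C = n"
  using assms(3,4)
proof (induction n rule: dec_induct)
  case base
  then show ?case using assms(2) by blast
next
  case (step n)
  then obtain C where C: "B \<subseteq> C" "lightest_in f A C" "card C = n" by auto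
  have fin: "finite C" using C(2) assms(1) by (auto simp: lightest_in_def intro: finite_subset)
  have "A - C \<noteq> {}"
    using C(3) step.prems card_mono[OF fin, of A] by auto
  then obtain x where x: "x \<in> A - C" "\<forall>y \<in> A - C. f x \<le> f y"
    using ex_is_arg_min_if_finite[of "A - C" f] assms(1)
    by (auto simp: is_arg_min_linorder)
  then have "lightest_in f A (insert x C)" "card (insert x C) = Suc n"
    using C fin by (auto intro: lightest_in_insert)
  then show ?case using C(1) by blast
qed

text \<open>The two cases of the definition merge: with fewer than \<open>k\<close> simple paths, a
  subset of full cardinality is the whole set and the order condition is vacuous.\<close>

lemma top_k_collections_iff:
  assumes "finite (simple_paths G s t)"
  shows "S \<in> top_k_collections G \<omega> k s t \<longleftrightarrow>
    lightest_in (path_weight \<omega>) (simple_paths G s t) S \<and>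
    card S = min k (card (simple_paths G s t))"
proof (cases "card (simple_paths G s t) < k")
  case True
  then show ?thesis using card_seteq[OF assms, of S]
    by (auto simp: top_k_collections_def lightest_in_def)
next
  case False
  then show ?thesis by (auto simp: top_k_collections_def lightest_in_def)
qed

text \<open>Justifies the call to P-kSSP: a lightest list can be padded to a collection, and a list
  of \<open>k\<close> paths leaves no room for others.\<close>

lemma top_k_collections_extend:
  assumes "finite (simple_paths G s t)"
    and "lightest_in (path_weight \<omega>) (simple_paths G s t) B" "card B \<le> k"
  shows "\<exists>S \<in> top_k_collections G \<omega> k s t. B \<subseteq> S \<and> (card B = k \<longrightarrow> S = B)"
proof -
  have "card B \<le> min k (card (simple_paths G s t))"
    using assms card_mono by (auto simp: lightest_in_def)
  then obtain S where S: "B \<subseteq> S" "lightest_in (path_weight \<omega>) (simple_paths G s t) S"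
      "card S = min k (card (simple_paths G s t))"
    using lightest_in_extend[OF assms(1,2), of "min k (card (simple_paths G s t))"] by auto
  have "finite S" using S(2) assms(1) by (auto simp: lightest_in_def intro: finite_subset)
  then have "S = B" if "card B = k"
    using S(1,3) that card_seteq[of S B] by simp
  moreover have "S \<in> top_k_collections G \<omega> k s t"
    using S(2,3) top_k_collections_iff[OF assms(1)] by blast
  ultimately show ?thesis using S(1) by blast
qed

section \<open>Termination\<close>

locale bounded_kssp = pair_fin_digraph G for G :: "'a pair_pre_digraph" +
  fixes \<omega> :: "('a \<times> 'a) weight_fun" and r :: 'a and k :: nat
  assumes weight_nonneg: "e \<in> parcs G \<Longrightarrow> 0 \<le> \<omega> e"
    and root_in_verts: "r \<in> pverts G"
    and k_pos: "1 \<le> k"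
begin

abbreviation "sp \<equiv> simple_paths G r"
abbreviation "wt \<equiv> path_weight \<omega>"

lemma finite_sp [simp]: "finite (sp v)"
  using pair_finite_verts by (rule finite_simple_paths)

lemmas top_k_iff = top_k_collections_iff[OF finite_sp]

text \<open>Non-negativity of the weights enters here: dropping end vertices one by one never
  increases the weight.\<close>

lemma wt_prefix_le:
  assumes "a @ b \<in> sp v" "a \<noteq> []"
  shows "wt a \<le> wt (a @ b)"
  using assms
proof (induction b arbitrary: v rule: rev_induct)
  case (snoc u b)
  from snoc.prems simple_paths_snoc_iff[of "a @ b" u G r v]
  have *: "a @ b \<in> sp (last (a @ b))" "(last (a @ b), u) \<in> parcs G" by auto
  show ?case
    using snoc.IH[OF *(1) snoc.prems(2)] weight_nonneg[OF *(2)] snoc.prems(2)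
      path_weight_snoc[of "a @ b" \<omega> u] by simp
qed simp

text \<open>Collects what iterations preserve however ties are broken, because termination is proved
  without the tie convention.\<close>

definition sound :: "'a kssp_state \<Rightarrow> bool" where
  "sound s \<longleftrightarrow>
     (\<forall>q \<in> queue s. q \<in> sp (last q)) \<and>
     (\<forall>v. set (paths s v) \<subseteq> sp v \<and> length (paths s v) \<le> k) \<and>
     supersat s \<subseteq> pverts G \<and>
     (\<forall>w \<in> supersat s. coll s w \<in> top_k_collections G \<omega> k r w)"

lemma sp_last_in_verts: "p \<in> sp v \<Longrightarrow> v \<in> pverts G"
  using simple_paths_setD[of p G r v] simple_paths_lastD[of p G r v]
    simple_paths_not_Nil[of p G r v] last_in_set[of p] by auto

lemma sound_finite_queue: "sound s \<Longrightarrow> finite (queue s)"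
proof -
  assume "sound s"
  then have "queue s \<subseteq> (\<Union>v \<in> pverts G. sp v)"
    unfolding sound_def using sp_last_in_verts by blast
  then show ?thesis
    by (rule finite_subset) (simp add: pair_finite_verts)
qed

lemma admissible_choice_top_k:
  assumes "sound s" "admissible_choice G \<omega> r k s S" "w \<in> pverts G"
  shows "S w \<in> top_k_collections G \<omega> k r w"
  using assms by (auto simp: sound_def admissible_choice_def split: if_splits)

text \<open>The collection chosen for a vertex consists of simple paths of \<open>G\<close>, so the
  closure never leaves the graph, where \<open>S\<close> is constrained.\<close>

lemma general_predecessors_in_verts:
  assumes "sound s" "admissible_choice G \<omega> r k s S" "v \<in> pverts G"
    and "u \<in> general_predecessors S v"
  shows "u \<in> pverts G"
  using assms(4)
proof induction
  case (pred w u)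
  then have "S w \<subseteq> sp w"
    using admissible_choice_top_k[OF assms(1,2)] by (auto simp: top_k_iff lightest_in_def)
  then show ?case using pred simple_paths_setD by (fastforce simp: predecessors_def)
qed (rule assms(3))

lemma sound_initial: "sound (initial_state r)"
  using simple_paths_self[OF root_in_verts] by (simp add: sound_def initial_state_def)

lemma sound_iteration:
  assumes "iteration G \<omega> r k s p s'" "sound s"
  shows "sound s'"
  using assms(1)
proof cases
  case (extend v)
  have p: "p \<in> sp v" using extend assms(2) by (auto simp: min_queued_def sound_def)
  have "p @ [u] \<in> sp u" if "(v, u) \<in> parcs G" "u \<notin> set p" for u
    using that p simple_paths_snoc_iff[of p u G r u] simple_paths_not_Nil[OF p]
      simple_paths_lastD[OF p] in_arcsD2 by auto
  then show ?thesis using extend p assms(2) by (auto simp: sound_def)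
next
  case (supersaturate v S X)
  have "v \<in> pverts G"
    using supersaturate assms(2) sp_last_in_verts by (auto simp: min_queued_def sound_def)
  then have X: "X \<subseteq> pverts G"
    using general_predecessors_in_verts[OF assms(2)] supersaturate by blast
  have S: "S w \<in> top_k_collections G \<omega> k r w" if "w \<in> X" for w
    using admissible_choice_top_k[OF assms(2)] supersaturate that X by blast
  then have "q \<in> sp w" if "w \<in> X" "q \<in> S w" for w q
    using that by (auto simp: top_k_iff lightest_in_def)
  then have "q \<in> sp (last q)" if "w \<in> X" "q \<in> S w" for w q
    using simple_paths_last that by metis
  then show ?thesis using supersaturate X S assms(2) by (auto simp: sound_def)
next
  case (discard v)
  then show ?thesis using assms(2) by (auto simp: sound_def)
qed

definition progress :: "'a kssp_state \<Rightarrow> nat \<times> nat \<times> nat" where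
  "progress s = (\<Sum>v \<in> pverts G. k - length (paths s v), card (pverts G - supersat s), card (queue s))"

text \<open>Extending fills a free place, super-saturating marks at least \<open>last p\<close>,
  discarding shrinks the queue. The first two may enlarge the queue, which is why its size comes
  last.\<close>

lemma progress_decreases:
  assumes "iteration G \<omega> r k s p s'" "sound s"
  shows "(progress s', progress s) \<in> less_than <*lex*> less_than <*lex*> less_than"
proof -
  have p: "p \<in> queue s"
    using assms(1) by (auto elim!: iteration.cases simp: min_queued_def)
  then have p_verts: "last p \<in> pverts G"
    using assms(2) sp_last_in_verts[of p "last p"] by (simp add: sound_def)
  note fin = pair_finite_verts
  from assms(1) show ?thesis
  proof cases
    case (extend v)
    have "(\<Sum>v \<in> pverts G. k - length (paths s' v)) < (\<Sum>v \<in> pverts G. k - length (paths s v))"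
      using extend p_verts by (intro sum_strict_mono_ex1 fin) auto
    then show ?thesis by (simp add: progress_def)
  next
    case (supersaturate v S X)
    then have "v \<in> X" "v \<in> pverts G" "v \<notin> supersat s" "X \<subseteq> supersat s'" "supersat s \<subseteq> supersat s'"
      using p_verts by (auto intro: general_predecessors.self)
    then have "card (pverts G - supersat s') < card (pverts G - supersat s)"
      by (intro psubset_card_mono finite_Diff fin) auto
    then show ?thesis using supersaturate by (simp add: progress_def)
  next
    case (discard v)
    have "card (queue s - {p}) < card (queue s)"
      using p sound_finite_queue[OF assms(2)] by (intro psubset_card_mono) auto
    then show ?thesis using discard by (simp add: progress_def)
  qed
qed

lemma no_infinite_run:
  "\<nexists>f. f 0 = initial_state r \<and> (\<forall>i. \<exists>p. iteration G \<omega> r k (f i) p (f (Suc i)))"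
proof
  assume "\<exists>f. f 0 = initial_state r \<and> (\<forall>i. \<exists>p. iteration G \<omega> r k (f i) p (f (Suc i)))"
  then obtain f where f: "f 0 = initial_state r"
    "\<And>i. \<exists>p. iteration G \<omega> r k (f i) p (f (Suc i))" by blast
  have "sound (f i)" for i
  proof (induction i)
    case (Suc i)
    then show ?case using f(2)[of i] sound_iteration by blast
  qed (simp add: f(1) sound_initial)
  then have "\<forall>i. (progress (f (Suc i)), progress (f i)) \<in> less_than <*lex*> less_than <*lex*> less_than"
    using f(2) progress_decreases by blast
  then have "\<exists>g. \<forall>i. (g (Suc i), g i) \<in> less_than <*lex*> less_than <*lex*> less_than"
    by (intro exI[of _ "\<lambda>i. progress (f i)"])
  moreover have "wf (less_than <*lex*> less_than <*lex*> less_than)" by auto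
  ultimately show False unfolding wf_iff_no_infinite_down_chain by contradiction
qed

end

section \<open>The loop invariant\<close>

text \<open>\<open>extended\<close> drives the coverage argument; \<open>parent\<close> ensures that
  extensions of a removed path are not listed already. Extensions into a super-saturated vertex are
  no longer inserted, so there the conditions on \<open>coll\<close> replace \<open>extended\<close>
  and \<open>lightest\<close>.\<close>

locale kssp_invariant = bounded_kssp +
  fixes s :: "'a kssp_state"
  assumes sound: "sound s"
    and distinct_paths: "distinct (paths s v)"
    and disjoint_queue: "set (paths s v) \<inter> queue s = {}"
    and root_path: "[r] \<in> set (paths s r) \<union> queue s"
    and extended: "\<lbrakk>p \<in> set (paths s (last p)); p @ [u] \<in> sp u; u \<notin> supersat s\<rbrakk>
          \<Longrightarrow> p @ [u] \<in> set (paths s u) \<union> queue s"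
    and parent: "\<lbrakk>p @ [u] \<in> set (paths s u) \<union> queue s; p \<noteq> []; u \<notin> supersat s\<rbrakk>
          \<Longrightarrow> p \<in> set (paths s (last p))"
    and supersat_closed: "w \<in> supersat s \<Longrightarrow> predecessors (coll s) w \<subseteq> supersat s"
    and paths_coll: "w \<in> supersat s \<Longrightarrow> set (paths s w) \<subseteq> coll s w"
    and coll_covered: "w \<in> supersat s \<Longrightarrow> coll s w \<subseteq> set (paths s w) \<union> queue s"
    and lightest: "v \<notin> supersat s \<Longrightarrow> lightest_in wt (sp v) (set (paths s v))"
begin

section \<open>Coverage of unlisted paths by the queue\<close>

lemma queue_sp: "q \<in> queue s \<Longrightarrow> q \<in> sp (last q)"
  and paths_sp: "q \<in> set (paths s v) \<Longrightarrow> q \<in> sp v"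
  and paths_le: "length (paths s v) \<le> k"
  and coll_top_k: "w \<in> supersat s \<Longrightarrow> coll s w \<in> top_k_collections G \<omega> k r w"
  using sound by (auto simp: sound_def)

text \<open>Walking along \<open>b\<close>, the extension of a listed prefix is listed or queued by
  \<open>extended\<close>; a queued prefix is no heavier than the whole path.\<close>

lemma chain:
  assumes "a \<in> set (paths s (last a))" "a @ b \<in> sp v" "set b \<inter> supersat s = {}"
  shows "a @ b \<in> set (paths s v) \<or> (\<exists>x \<in> queue s. wt x \<le> wt (a @ b))"
  using assms(2,3)
proof (induction b arbitrary: v rule: rev_induct)
  case Nil
  then show ?case using assms(1) simple_paths_lastD by fastforce
next
  case (snoc u b)
  have ne: "a @ b \<noteq> []" using simple_paths_not_Nil[OF paths_sp[OF assms(1)]] by simp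
  from snoc.prems(1) have mem: "(a @ b) @ [u] \<in> sp v" by simp
  then have ab: "a @ b \<in> sp (last (a @ b))" and v: "v = u"
    using simple_paths_snoc_iff[OF ne] by blast+
  have le: "wt (a @ b) \<le> wt ((a @ b) @ [u])" by (rule wt_prefix_le[OF mem ne])
  have u: "u \<notin> supersat s" using snoc.prems(2) by simp
  from snoc.IH[OF ab] snoc.prems(2) consider
    "a @ b \<in> set (paths s (last (a @ b)))" | x where "x \<in> queue s" "wt x \<le> wt (a @ b)" by auto
  then show ?case
  proof cases
    case 1
    from extended[OF this _ u] mem v show ?thesis by auto
  next
    case 2
    then show ?thesis using le by (auto intro: order_trans)
  qed
qed

lemma coverage:
  assumes "v \<notin> supersat s" "length (paths s v) < k" "q \<in> sp v" "q \<notin> set (paths s v)"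
  shows "\<exists>x \<in> queue s. wt x \<le> wt q"
proof (cases "set q \<inter> supersat s = {}")
  case True
  \<comment> \<open>With no super-saturated vertex on \<open>q\<close>, the trivial path at
    \<open>r\<close> starts the chain.\<close>
  obtain b where b: "q = [r] @ b"
    using assms(3) simple_paths_not_Nil[OF assms(3)] by (cases q) (auto simp: simple_paths_def)
  from root_path show ?thesis
  proof
    assume "[r] \<in> set (paths s r)"
    then show ?thesis using chain[of "[r]" b v] assms(3,4) True b by auto
  next
    assume "[r] \<in> queue s"
    then show ?thesis using wt_prefix_le[of "[r]" b v] assms(3) b by auto
  qed
next
  case False
  then have "\<exists>y \<in> set q. y \<in> supersat s" by auto
  then obtain a' x b where q: "q = a' @ x # b" and x: "x \<in> supersat s"
    and b: "\<forall>y \<in> set b. y \<notin> supersat s"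
    using split_list_last_prop[of q "\<lambda>y. y \<in> supersat s"] by blast
  define a where "a = a' @ [x]"
  have qab: "q = a @ b" and a: "a \<noteq> []" "last a = x" using q by (simp_all add: a_def)
  have b_disj: "set b \<inter> supersat s = {}" using b by auto
  have asp: "a \<in> sp x" using simple_paths_prefix[of a b] assms(3) qab a by auto
  have le: "wt a \<le> wt q" using wt_prefix_le[of a b v] assms(3) qab a by simp
  have C: "lightest_in wt (sp x) (coll s x)" "card (coll s x) = min k (card (sp x))"
    using coll_top_k[OF x] by (auto simp: top_k_iff)
  show ?thesis
  proof (cases "a \<in> coll s x")
    case True
    then consider "a \<in> set (paths s x)" | "a \<in> queue s" using coll_covered[OF x] by auto
    then show ?thesis
    proof cases
      case 1
      then show ?thesis using chain[of a b v] a assms(3,4) qab b_disj by auto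
    qed (use le in auto)
  next
    case False
    then have lighter: "wt t \<le> wt a" if "t \<in> coll s x" for t
      using that asp C(1) by (auto simp: lightest_in_def)
    show ?thesis
    proof (cases "coll s x \<subseteq> set (paths s x)")
      case False
      then obtain t where "t \<in> coll s x" "t \<in> queue s" using coll_covered[OF x] by auto
      then show ?thesis using lighter le order_trans by blast
    next
      case True
      \<comment> \<open>The collection misses \<open>a\<close>, so it is not the set of all simple
        paths to \<open>x\<close> and must have size \<open>k\<close>.\<close>
      have "card (coll s x) < card (sp x)"
        using \<open>a \<notin> coll s x\<close> asp C(1) by (intro psubset_card_mono) (auto simp: lightest_in_def)
      then have card: "card (coll s x) = k" using C(2) by simp
      have spliced: "t @ b \<in> sp v" "wt (t @ b) \<le> wt q" if t: "t \<in> coll s x" for t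
      proof -
        have tsp: "t \<in> sp x" using t C(1) by (auto simp: lightest_in_def)
        \<comment> \<open>Each vertex of \<open>t\<close> is \<open>x\<close> or a predecessor of
          \<open>x\<close>, hence super-saturated, whereas no vertex of \<open>b\<close> is.\<close>
        have "set t \<subseteq> insert x (predecessors (coll s) x)"
          using t by (auto simp: predecessors_def)
        then have "set t \<inter> set b = {}" using supersat_closed[OF x] x b_disj by auto
        then show "t @ b \<in> sp v"
          using simple_paths_exchange_prefix[of a b G r v t] assms(3) qab a tsp by simp
        show "wt (t @ b) \<le> wt q"
          using lighter[OF t] path_weight_append[of t \<omega> b] path_weight_append[of a \<omega> b]
            simple_paths_not_Nil[OF tsp] simple_paths_lastD[OF tsp] a qab by simp
      qed
      \<comment> \<open>The \<open>k\<close> continuations are pairwise different, but fewer than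
        \<open>k\<close> paths are listed at \<open>v\<close>.\<close>
      have "\<not> (\<lambda>t. t @ b) ` coll s x \<subseteq> set (paths s v)"
      proof
        assume "(\<lambda>t. t @ b) ` coll s x \<subseteq> set (paths s v)"
        then have "card ((\<lambda>t. t @ b) ` coll s x) \<le> card (set (paths s v))"
          by (rule card_mono[rotated]) simp
        moreover have "card ((\<lambda>t. t @ b) ` coll s x) = k"
          using card by (subst card_image) (auto simp: inj_on_def)
        ultimately show False using assms(2) card_length[of "paths s v"] by simp
      qed
      then obtain t where t: "t \<in> coll s x" "t @ b \<notin> set (paths s v)" by blast
      then have "t \<in> set (paths s (last t))"
        using True paths_sp simple_paths_lastD by (metis subsetD)
      from chain[OF this spliced(1)[OF t(1)] b_disj] t show ?thesis
        using spliced(2)[OF t(1)] order_trans by blast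
    qed
  qed
qed

section \<open>Full lists, available choices and the result on exit\<close>

lemma card_paths: "card (set (paths s v)) = length (paths s v)"
  using distinct_paths by (rule distinct_card)

text \<open>A list of \<open>k\<close> distinct paths inside a collection of at most
  \<open>k\<close> paths exhausts it.\<close>

lemma saturated_coll:
  assumes "w \<in> supersat s" "\<not> length (paths s w) < k"
  shows "coll s w = set (paths s w)"
proof -
  have "finite (coll s w)" using coll_covered[OF assms(1)] sound_finite_queue[OF sound]
    by (auto intro: finite_subset)
  moreover have "card (coll s w) \<le> k" using coll_top_k[OF assms(1)] by (simp add: top_k_iff)
  ultimately show ?thesis
    using card_seteq[OF _ paths_coll[OF assms(1)]] assms(2) card_paths[of w] by simp
qed

text \<open>Off \<open>supersat\<close> the lists are lightest and hence extend to collections;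
  elsewhere the stored value is reused.\<close>

lemma admissible_choice_exists: "\<exists>S. admissible_choice G \<omega> r k s S"
proof -
  have "\<exists>C. if w \<in> supersat s then C = coll s w
        else C \<in> top_k_collections G \<omega> k r w \<and> set (paths s w) \<subseteq> C \<and>
             (length (paths s w) = k \<longrightarrow> C = set (paths s w))" for w
    using top_k_collections_extend[OF finite_sp lightest, of w k] card_paths[of w] paths_le[of w]
    by auto
  then have "\<exists>S. \<forall>w. if w \<in> supersat s then S w = coll s w
        else S w \<in> top_k_collections G \<omega> k r w \<and> set (paths s w) \<subseteq> S w \<and>
             (length (paths s w) = k \<longrightarrow> S w = set (paths s w))"
    by (intro choice) blast
  then show ?thesis unfolding admissible_choice_def by blast
qed

lemma iteration_exists:
  assumes "loop_guard G r k s" "min_queued \<omega> s p"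
  shows "\<exists>s'. iteration G \<omega> r k s p s'"
proof -
  obtain S where "admissible_choice G \<omega> r k s S" using admissible_choice_exists by blast
  then show ?thesis
    using iteration.extend[OF assms refl _ refl] iteration.discard[OF assms refl _ _ refl]
      iteration.supersaturate[OF assms refl _ _ _ refl refl] by blast
qed

text \<open>If a minimum violates the convention, the queued path witnessing this is itself a
  minimum and lies in the collection, so it obeys the convention.\<close>

lemma conventional_min_exists:
  assumes "queue s \<noteq> {}"
  shows "\<exists>p. min_queued \<omega> s p \<and> tie_convention \<omega> s p"
proof -
  obtain p where p: "min_queued \<omega> s p"
    using ex_is_arg_min_if_finite[OF sound_finite_queue[OF sound] assms, of wt]
    by (auto simp: min_queued_def is_arg_min_linorder)
  show ?thesis
  proof (cases "tie_convention \<omega> s p")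
    case False
    then obtain q where "q \<in> queue s" "last q = last p" "wt q = wt p" "q \<in> coll s (last p)"
      by (auto simp: tie_convention_def)
    then have "min_queued \<omega> s q \<and> tie_convention \<omega> s q"
      using p by (simp add: min_queued_def tie_convention_def)
    then show ?thesis by blast
  qed (use p in blast)
qed

text \<open>After the loop, a short list at a vertex other than \<open>r\<close> forces an empty
  queue; then \<open>coll_covered\<close> or \<open>coverage\<close> leaves nothing unlisted. A full
  list is settled by \<open>saturated_coll\<close> or \<open>lightest\<close>.\<close>

lemma result_top_k:
  assumes "\<not> loop_guard G r k s" "v \<in> pverts G - {r}"
  shows "set (paths s v) \<in> top_k_collections G \<omega> k r v"
proof (cases "v \<in> supersat s")
  case True
  have "coll s v = set (paths s v)"
  proof (cases "length (paths s v) < k")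
    case less: True
    then have "queue s = {}" using assms by (auto simp: loop_guard_def)
    then show ?thesis using coll_covered[OF True] paths_coll[OF True] by auto
  qed (rule saturated_coll[OF True])
  then show ?thesis using coll_top_k[OF True] by simp
next
  case False
  note light = lightest[OF False]
  show ?thesis
  proof (cases "length (paths s v) < k")
    case True
    then have "queue s = {}" using assms by (auto simp: loop_guard_def)
    then have "set (paths s v) = sp v"
      using coverage[OF False True] light by (auto simp: lightest_in_def)
    then show ?thesis using light True card_paths[of v] by (simp add: top_k_iff)
  next
    case sat: False
    then have "card (set (paths s v)) = k" using paths_le[of v] card_paths[of v] by simp
    moreover have "card (set (paths s v)) \<le> card (sp v)"
      using light by (intro card_mono) (auto simp: lightest_in_def)
    ultimately show ?thesis using light by (simp add: top_k_iff)
  qed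
qed

section \<open>Preservation of the invariant\<close>

text \<open>This is the only step that depends on the tie convention.\<close>

lemma min_queued_in_coll:
  assumes "min_queued \<omega> s p" "tie_convention \<omega> s p" "last p \<in> supersat s"
    and "length (paths s (last p)) < k"
  shows "p \<in> coll s (last p)"
proof (rule ccontr)
  assume p: "p \<notin> coll s (last p)"
  let ?C = "coll s (last p)"
  have psp: "p \<in> sp (last p)" using assms(1) queue_sp by (simp add: min_queued_def)
  have C: "lightest_in wt (sp (last p)) ?C" "card ?C = min k (card (sp (last p)))"
    using coll_top_k[OF assms(3)] by (auto simp: top_k_iff)
  have "card ?C < card (sp (last p))"
    using p psp C(1) by (intro psubset_card_mono) (auto simp: lightest_in_def)
  then have "\<not> ?C \<subseteq> set (paths s (last p))"
    using C(2) assms(4) card_paths[of "last p"] card_mono[of "set (paths s (last p))" ?C] by auto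
  then obtain q where q: "q \<in> ?C" "q \<in> queue s" using coll_covered[OF assms(3)] by auto
  \<comment> \<open>\<open>p\<close> is minimal in the queue but outside a lightest set containing
    \<open>q\<close>, so the two tie, which is the situation the convention excludes.\<close>
  then have "wt q \<le> wt p" using C(1) p psp by (auto simp: lightest_in_def)
  moreover have "wt p \<le> wt q" using q assms(1) by (simp add: min_queued_def)
  moreover have "last q = last p"
    using q C(1) simple_paths_lastD by (fastforce simp: lightest_in_def)
  ultimately show False using assms(2,3) q p by (auto simp: tie_convention_def)
qed

text \<open>If \<open>last p\<close> is not super-saturated, coverage makes \<open>p\<close>
  lightest among its unlisted paths; otherwise \<open>min_queued_in_coll\<close> keeps the list
  inside the collection.\<close>

lemma invariant_extend:
  assumes iter: "iteration G \<omega> r k s p s'"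
    and min: "min_queued \<omega> s p" and tie: "tie_convention \<omega> s p"
    and less: "length (paths s (last p)) < k"
    and s': "s' = s\<lparr>paths := (paths s)(last p := paths s (last p) @ [p]),
             queue := (queue s - {p}) \<union>
               {p @ [u] | u. (last p, u) \<in> parcs G \<and> u \<notin> set p \<and> u \<notin> supersat s}\<rparr>"
  shows "kssp_invariant G \<omega> r k s'"
proof -
  have p: "p \<in> queue s" using min by (simp add: min_queued_def)
  have psp: "p \<in> sp (last p)" using queue_sp[OF p] .
  have p_new: "p \<notin> set (paths s x)" for x using p disjoint_queue by blast
  have ne: "p \<noteq> []" using psp by (rule simple_paths_not_Nil)
  have paths': "set (paths s' x) = (if x = last p then insert p (set (paths s x)) else set (paths s x))" for x
    by (simp add: s')
  have queue': "queue s' = (queue s - {p}) \<union>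
      {p @ [u] | u. (last p, u) \<in> parcs G \<and> u \<notin> set p \<and> u \<notin> supersat s}" by (simp add: s')
  have ss: "supersat s' = supersat s" "coll s' = coll s" by (simp_all add: s')
  show ?thesis
  proof unfold_locales
    show "sound s'" by (rule sound_iteration[OF iter sound])
    show "distinct (paths s' v)" for v
      using distinct_paths p_new by (simp add: s')
    show "set (paths s' v) \<inter> queue s' = {}" for v
    proof -
      \<comment> \<open>Were the extension listed, \<open>parent\<close> would make \<open>p\<close>
        listed too, although it is queued.\<close>
      have "p @ [u] \<notin> set (paths s v)" if "u \<notin> supersat s" for u
      proof
        assume *: "p @ [u] \<in> set (paths s v)"
        then have "v = u" using simple_paths_lastD[OF paths_sp[OF *]] by simp
        then show False using parent[of p u] * ne that p_new by blast
      qed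
      then show ?thesis using disjoint_queue[of v] by (auto simp: paths' queue')
    qed
    show "[r] \<in> set (paths s' r) \<union> queue s'"
      using root_path by (auto simp: paths' queue')
    show "q @ [u] \<in> set (paths s' u) \<union> queue s'"
      if "q \<in> set (paths s' (last q))" "q @ [u] \<in> sp u" "u \<notin> supersat s'" for q u
    proof (cases "q = p")
      case True
      then show ?thesis using that simple_paths_snoc_iff[OF ne, of u G r u] ss by (auto simp: queue')
    next
      case False
      then have "q \<in> set (paths s (last q))" using that(1) by (auto simp: paths' split: if_splits)
      then have "q @ [u] \<in> set (paths s u) \<union> queue s" using extended that ss by simp
      then show ?thesis by (auto simp: paths' queue')
    qed
    show "q \<in> set (paths s' (last q))"
      if "q @ [u] \<in> set (paths s' u) \<union> queue s'" "q \<noteq> []" "u \<notin> supersat s'" for q u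
    proof (cases "q = p")
      case False
      then have "q @ [u] \<in> set (paths s u) \<union> queue s"
        using that(1) p by (auto simp: paths' queue' split: if_splits)
      then have "q \<in> set (paths s (last q))" using parent[of q u] that ss by simp
      then show ?thesis by (auto simp: paths')
    qed (simp add: paths')
    show "predecessors (coll s') w \<subseteq> supersat s'" if "w \<in> supersat s'" for w
      using supersat_closed that ss by simp
    show "set (paths s' w) \<subseteq> coll s' w" if "w \<in> supersat s'" for w
      using paths_coll[of w] min_queued_in_coll[OF min tie _ less] that ss by (auto simp: paths')
    show "coll s' w \<subseteq> set (paths s' w) \<union> queue s'" if w: "w \<in> supersat s'" for w
    proof
      fix q assume "q \<in> coll s' w"
      then have q: "q \<in> coll s w" using ss by simp
      \<comment> \<open>The endpoint is fixed by the collection, so if \<open>q\<close> is the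
        removed \<open>p\<close>, it has moved to the list of \<open>w\<close> itself.\<close>
      then have "last q = w" using coll_top_k[of w] w ss simple_paths_lastD
        by (fastforce simp: top_k_iff lightest_in_def)
      then show "q \<in> set (paths s' w) \<union> queue s'"
        using q coll_covered[of w] w ss by (auto simp: paths' queue')
    qed
    show "lightest_in wt (sp v) (set (paths s' v))" if "v \<notin> supersat s'" for v
    proof (cases "v = last p")
      case True
      \<comment> \<open>Coverage yields a queued path no heavier than \<open>q\<close>, and
        \<open>p\<close> is minimal in the queue.\<close>
      have "wt p \<le> wt q" if "q \<in> sp v - set (paths s v)" for q
        using coverage[of v q] that \<open>v \<notin> supersat s'\<close> less True ss min
        by (fastforce simp: min_queued_def)
      then show ?thesis
        using lightest_in_insert[OF lightest[of v], of p] True psp p_new that ss by (simp add: paths')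
    qed (use that lightest ss in \<open>simp add: paths'\<close>)
  qed
qed

text \<open>Enlarging \<open>supersat\<close> only weakens the demands of \<open>extended\<close>,
  \<open>parent\<close> and \<open>lightest\<close>; \<open>supersat\<close> stays closed because
  \<open>X\<close> completes a whole closure under predecessors.\<close>

lemma invariant_supersaturate:
  assumes iter: "iteration G \<omega> r k s p s'"
    and min: "min_queued \<omega> s p"
    and full: "\<not> length (paths s (last p)) < k" and unsat: "last p \<notin> supersat s"
    and adm: "admissible_choice G \<omega> r k s S"
    and X: "X = general_predecessors S (last p) - supersat s"
    and s': "s' = s\<lparr>queue := (queue s - {p}) \<union> (\<Union>w \<in> X. S w - set (paths s w)),
             supersat := supersat s \<union> X,
             coll := (\<lambda>w. if w \<in> X then S w else coll s w)\<rparr>"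
  shows "kssp_invariant G \<omega> r k s'"
proof -
  have p: "p \<in> queue s" using min by (simp add: min_queued_def)
  have psp: "p \<in> sp (last p)" using queue_sp[OF p] .
  have pv: "last p \<in> pverts G" using psp by (rule sp_last_in_verts)
  have lastX: "last p \<in> X" using unsat X general_predecessors.self by auto
  have XV: "X \<subseteq> pverts G" using general_predecessors_in_verts[OF sound adm pv] X by auto
  have full_eq: "length (paths s (last p)) = k" using full paths_le[of "last p"] by simp
  have S: "S w \<in> top_k_collections G \<omega> k r w" "set (paths s w) \<subseteq> S w" if "w \<in> X" for w
    using adm that XV X by (auto simp: admissible_choice_def split: if_splits)
  have S_last: "S w \<subseteq> {q. last q = w}" if "w \<in> X" for w
    using S(1)[OF that] simple_paths_lastD by (fastforce simp: top_k_iff lightest_in_def)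
  have Sv: "S (last p) = set (paths s (last p))"
    using adm pv unsat full_eq by (simp add: admissible_choice_def)
  have p_new: "p \<notin> set (paths s x)" for x using p disjoint_queue by blast
  have paths': "paths s' = paths s" and
    queue': "queue s' = (queue s - {p}) \<union> (\<Union>w \<in> X. S w - set (paths s w))" and
    ss: "supersat s' = supersat s \<union> X" and
    coll': "coll s' w = (if w \<in> X then S w else coll s w)" for w
    by (simp_all add: s')
  have pX: "last p \<in> supersat s'" using lastX ss by simp
  show ?thesis
  proof unfold_locales
    show "sound s'" by (rule sound_iteration[OF iter sound])
    show "distinct (paths s' v)" for v using distinct_paths by (simp add: paths')
    show "set (paths s' v) \<inter> queue s' = {}" for v
    proof -
      \<comment> \<open>A path determines its end, so collection members can only be listed at their
        own vertex, where the listed ones are subtracted.\<close>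
      have "v = w" if "q \<in> set (paths s v)" "q \<in> S w" "w \<in> X" for q w
        using that S_last simple_paths_lastD[OF paths_sp] by auto
      then show ?thesis using disjoint_queue[of v] by (auto simp: paths' queue')
    qed
    \<comment> \<open>\<open>[r]\<close> is the only simple path to \<open>r\<close>. If it were
      \<open>p\<close>, the full list of \<open>r\<close>, non-empty by \<open>k_pos\<close>, would
      contain a queued path.\<close>
    have "p \<noteq> [r]"
    proof
      assume pr: "p = [r]"
      then obtain t where "t \<in> set (paths s r)" using full_eq k_pos by (cases "paths s r") auto
      then show False using simple_paths_selfD[OF paths_sp] p_new[of r] pr by auto
    qed
    then show "[r] \<in> set (paths s' r) \<union> queue s'" using root_path by (auto simp: paths' queue')
    show "q @ [u] \<in> set (paths s' u) \<union> queue s'"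
      if "q \<in> set (paths s' (last q))" "q @ [u] \<in> sp u" "u \<notin> supersat s'" for q u
      \<comment> \<open>The removed \<open>p\<close> is not the extension sought, since it ends at a
        vertex that is now super-saturated.\<close>
      using extended[of q u] that pX by (auto simp: paths' queue' ss)
    show "q \<in> set (paths s' (last q))"
      if "q @ [u] \<in> set (paths s' u) \<union> queue s'" "q \<noteq> []" "u \<notin> supersat s'" for q u
    proof -
      have "q @ [u] \<notin> S w" if "w \<in> X" for w
        using S_last[OF that] that \<open>u \<notin> supersat s'\<close> ss by auto
      then show ?thesis using parent[of q u] that by (auto simp: paths' queue' ss)
    qed
    show "predecessors (coll s') w \<subseteq> supersat s'" if w: "w \<in> supersat s'" for w
    proof (cases "w \<in> X")
      case True
      then have "predecessors (coll s') w = predecessors S w" by (simp add: predecessors_def coll')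
      moreover have "predecessors S w \<subseteq> general_predecessors S (last p)"
        using True X general_predecessors.pred by fastforce
      ultimately show ?thesis using X ss by auto
    next
      case False
      then have "predecessors (coll s') w = predecessors (coll s) w"
        by (simp add: predecessors_def coll')
      then show ?thesis using supersat_closed[of w] w False ss by auto
    qed
    show "set (paths s' w) \<subseteq> coll s' w" if "w \<in> supersat s'" for w
      using paths_coll[of w] S(2) that by (auto simp: paths' coll' ss)
    show "coll s' w \<subseteq> set (paths s' w) \<union> queue s'" if w: "w \<in> supersat s'" for w
    proof (cases "w \<in> X")
      case True
      then show ?thesis by (auto simp: paths' queue' coll')
    next
      case False
      then have w: "w \<in> supersat s" using that ss by simp
      then have "coll s w \<subseteq> {q. last q = w}"
        using coll_top_k[of w] simple_paths_lastD by (fastforce simp: top_k_iff lightest_in_def)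
      \<comment> \<open>Here \<open>w\<close> was super-saturated before this iteration, while the
        end of \<open>p\<close> was not.\<close>
      then have "p \<notin> coll s w" using w unsat by auto
      then show ?thesis using coll_covered[OF w] False by (auto simp: paths' queue' coll')
    qed
    show "lightest_in wt (sp v) (set (paths s' v))" if "v \<notin> supersat s'" for v
      using lightest that by (simp add: paths' ss)
  qed
qed

text \<open>No collection loses a member: the full list at \<open>last p\<close> already is the
  collection by \<open>saturated_coll\<close>, and \<open>p\<close> is not listed.\<close>

lemma invariant_discard:
  assumes iter: "iteration G \<omega> r k s p s'"
    and min: "min_queued \<omega> s p"
    and full: "\<not> length (paths s (last p)) < k" and sat: "last p \<in> supersat s"
    and s': "s' = s\<lparr>queue := queue s - {p}\<rparr>"
  shows "kssp_invariant G \<omega> r k s'"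
proof -
  have p: "p \<in> queue s" using min by (simp add: min_queued_def)
  have p_new: "p \<notin> set (paths s x)" for x using p disjoint_queue by blast
  have [simp]: "paths s' = paths s" "queue s' = queue s - {p}" "supersat s' = supersat s"
    "coll s' = coll s" by (simp_all add: s')
  show ?thesis
  proof unfold_locales
    show "sound s'" by (rule sound_iteration[OF iter sound])
    show "set (paths s' v) \<inter> queue s' = {}" for v using disjoint_queue[of v] by auto
    have "p \<noteq> [r]"
    proof
      assume pr: "p = [r]"
      then obtain t where "t \<in> set (paths s r)" using full k_pos by (cases "paths s r") auto
      then show False using simple_paths_selfD[OF paths_sp] p_new[of r] pr by auto
    qed
    then show "[r] \<in> set (paths s' r) \<union> queue s'" using root_path by auto
    show "q @ [u] \<in> set (paths s' u) \<union> queue s'"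
      if "q \<in> set (paths s' (last q))" "q @ [u] \<in> sp u" "u \<notin> supersat s'" for q u
      using extended[of q u] that sat by auto
    show "coll s' w \<subseteq> set (paths s' w) \<union> queue s'" if "w \<in> supersat s'" for w
    proof -
      have w: "w \<in> supersat s" using that by simp
      have "coll s w \<subseteq> {q. last q = w}"
        using coll_top_k[OF w] simple_paths_lastD by (fastforce simp: top_k_iff lightest_in_def)
      moreover have "coll s (last p) = set (paths s (last p))" by (rule saturated_coll[OF sat full])
      ultimately have "p \<notin> coll s w" using p_new by auto
      then show ?thesis using coll_covered[OF w] by auto
    qed
  qed (use distinct_paths parent supersat_closed paths_coll lightest in auto)
qed

lemma invariant_step:
  assumes "iteration G \<omega> r k s p s'" "tie_convention \<omega> s p"
  shows "kssp_invariant G \<omega> r k s'"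
  using assms(1)
proof cases
  case (extend v)
  then show ?thesis using invariant_extend[OF assms(1) _ assms(2)] by simp
next
  case (supersaturate v S X)
  then show ?thesis using invariant_supersaturate[OF assms(1)] by simp
next
  case (discard v)
  then show ?thesis using invariant_discard[OF assms(1)] by simp
qed

end

section \<open>Reachable states and correctness of the algorithm\<close>

context bounded_kssp
begin

lemma invariant_initial: "kssp_invariant G \<omega> r k (initial_state r)"
  by unfold_locales (use sound_initial in \<open>auto simp: initial_state_def lightest_in_def\<close>)

lemma invariant_reachable: "reachable_state G \<omega> r k s \<Longrightarrow> kssp_invariant G \<omega> r k s"
  unfolding reachable_state_def
  by (induction rule: rtranclp_induct)
    (auto intro: invariant_initial kssp_invariant.invariant_step)

end

theorem theorem5:
  fixes G :: "'a pair_pre_digraph" and \<omega> :: "('a \<times> 'a) weight_fun" and r :: 'a and k :: nat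
  assumes "pair_fin_digraph G"
    and "\<forall>e \<in> parcs G. 0 \<le> \<omega> e"
    and "r \<in> pverts G"
    and "1 \<le> k"
  shows
    "(\<nexists>f. f 0 = initial_state r \<and> (\<forall>i. \<exists>p. iteration G \<omega> r k (f i) p (f (Suc i)))) \<and>
     (\<forall>s. reachable_state G \<omega> r k s \<and> loop_guard G r k s \<longrightarrow>
        (\<exists>p. min_queued \<omega> s p \<and> tie_convention \<omega> s p) \<and>
        (\<forall>p. min_queued \<omega> s p \<longrightarrow> (\<exists>s'. iteration G \<omega> r k s p s'))) \<and>
     (\<forall>s. reachable_state G \<omega> r k s \<and> \<not> loop_guard G r k s \<longrightarrow>
        (\<forall>v \<in> pverts G - {r}.
           distinct (paths s v) \<and> set (paths s v) \<in> top_k_collections G \<omega> k r v))"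
proof -
  interpret bounded_kssp G \<omega> r k
    using assms by (simp add: bounded_kssp_def bounded_kssp_axioms_def)
  have "\<exists>p. min_queued \<omega> s p \<and> tie_convention \<omega> s p"
    if "reachable_state G \<omega> r k s" "loop_guard G r k s" for s
    using that kssp_invariant.conventional_min_exists[OF invariant_reachable]
    by (simp add: loop_guard_def)
  moreover have "\<exists>s'. iteration G \<omega> r k s p s'"
    if "reachable_state G \<omega> r k s" "loop_guard G r k s" "min_queued \<omega> s p" for s p
    using that kssp_invariant.iteration_exists[OF invariant_reachable] by blast
  moreover have "distinct (paths s v) \<and> set (paths s v) \<in> top_k_collections G \<omega> k r v"
    if "reachable_state G \<omega> r k s" "\<not> loop_guard G r k s" "v \<in> pverts G - {r}" for s v
    using that kssp_invariant.distinct_paths[OF invariant_reachable]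
      kssp_invariant.result_top_k[OF invariant_reachable] by blast
  ultimately show ?thesis using no_infinite_run by blast
qed

end
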